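(* Any split abelian extension of $3$-Lie algebras is isomorphic to a generalized semidirect product $3$-Lie algebra. That is, if $0\to V\xrightarrow{i}\hat{\mathfrak g}\xrightarrow{p}\mathfrak g\to0$ is a split abelian extension of a $3$-Lie algebra $\mathfrak g$ by $V$, then there is a generalized representation $(V;\rho,\nu)$ of $\mathfrak g$ on $V$ such that $\hat{\mathfrak g}$ is isomorphic, as a $3$-Lie algebra, to the generalized semidirect product $(\mathfrak g\oplus V,[\cdot,\cdot,\cdot]_{(\rho,\nu)})$.
   Context: All vector spaces are over an algebraically closed field $\mathbb K$ of characteristic $0$. A $3$-Lie algebra is a vector space $\mathfrak g$ with a skew-symmetric trilinear map $[\cdot,\cdot,\cdot]:\otimes^3\mathfrak g\to\mathfrak g$ satisfying the Fundamental Identity: $[x_1,x_2,[x_3,x_4,x_5]]=[[x_1,x_2,x_3],x_4,x_5]+[x_3,[x_1,x_2,x_4],x_5]+[x_3,x_4,[x_1,x_2,x_5]]$ for all $x_i\in\mathfrak g$. Abelian extensions. Given an exact sequence of $3$-Lie algebras $0\to V\xrightarrow{i}\hat{\mathfrak g}\xrightarrow{p}\mathfrak g\to0$, $\hat{\mathfrak g}$ is called an abelian extension of $\mathfrak g$ by $V$ if $V$ is abelian (i.e. the $3$-Lie bracket of $V$ is zero). A splitting is a linear map $\sigma:\mathfrak g\to\hat{\mathfrak g}$ with $p\circ\sigma=\mathrm{id}_{\mathfrak g}$. The abelian extension is split if there is a splitting that is a homomorphism of $3$-Lie algebras. Graded Lie algebra of a vector space $W$. For $p\ge 0$ let $C^p(W,W)$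 be the space of linear maps $\alpha:(\wedge^2W)^{\otimes p}\otimes W\to W$ which (for $p\ge1$) are skew-symmetric in the last three arguments, i.e. linear maps on $\wedge^2W\otimes\cdots\otimes\wedge^2W\wedge W$ ($p$ factors $\wedge^2W$). For $\alpha\in C^p(W,W)$, $\beta\in C^q(W,W)$ put $[\alpha,\beta]^{\mathrm{3Lie}}=(-1)^{pq}\alpha\circ\beta-\beta\circ\alpha\in C^{p+q}(W,W)$. Here, for $\mathfrak X_i=x_i\wedge y_i\in\wedge^2W$ ($1\le i\le p+q$) and $x\in W$, $$\begin{aligned}\alpha\circ\beta(\mathfrak X_1,\ldots,\mathfrak X_{p+q},x)=&\sum_{J,\,j_{q+1}<p+q+1}(-1)^{(J,I)}(-1)^k\Big(\alpha(\mathfrak X_{i_1},\ldots,\mathfrak X_{i_k},\beta(\mathfrak X_{j_1},\ldots,\mathfrak X_{j_q},x_{j_{q+1}})\wedge y_{j_{q+1}},\mathfrak X_{i_{k+1}},\ldots,\mathfrak X_{i_{p-1}},x)\\&\quad+\alpha(\mathfrak X_{i_1},\ldots,\mathfrak X_{i_k},x_{j_{q+1}}\wedge\beta(\mathfrak X_{j_1},\ldots,\mathfrak X_{j_q},y_{j_{q+1}}),\mathfrak X_{i_{k+1}},\ldots,\mathfrak X_{i_{p-1}},x)\Big)\\&+\sum_{J,\,j_{q+1}=p+q+1}(-1)^{(J,I)}(-1)^p\alpha(\mathfrak X_{i_1},\ldots,\mathfrak X_{i_p},\beta(\mathfrak X_{j_1},\ldots,\mathfrak X_{j_q},x)),\end{aligned}$$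 where $J=\{j_1<\cdots<j_{q+1}\}$ runs over the $(q+1)$-element subsets of $N=\{1,\ldots,p+q+1\}$, $I=\{i_1<\cdots<i_p\}=N\setminus J$, $(-1)^{(J,I)}$ is the sign of the permutation $(j_1,\ldots,j_{q+1},i_1,\ldots,i_p)$, and $k$ is determined by $i_k<j_{q+1}<i_{k+1}$ ($k=0$ if $j_{q+1}<i_1$, $k=p-1$ if $j_{q+1}>i_{p-1}$). Generalized representation. Take $W=\mathfrak g\oplus V$. Let $\pi$ be the bracket of $\mathfrak g$ extended by zero: $\pi(x+u,y+v,z+w)=[x,y,z]$. A generalized representation $(V;\rho,\nu)$ of $\mathfrak g$ on a vector space $V$ consists of linear maps $\rho:\wedge^2\mathfrak g\to\mathfrak{gl}(V)$ and $\nu:\mathfrak g\to\mathrm{Hom}(\wedge^2V,V)$ such that $[\pi+\bar\rho+\bar\nu,\pi+\bar\rho+\bar\nu]^{\mathrm{3Lie}}=0$, where $\bar\rho(x+u,y+v,z+w)=\rho(x,y)(w)+\rho(y,z)(u)+\rho(z,x)(v)$ and $\bar\nu(x+u,y+v,z+w)=\nu(x)(v\wedge w)+\nu(y)(w\wedge u)+\nu(z)(u\wedge v)$. The generalized semidirect product is the $3$-Lie algebra $\mathfrak g\oplus V$ with bracket $$[x+u,y+v,z+w]_{(\rho,\nu)}=[x,y,z]+\rho(x,y)(w)+\rho(y,z)(u)+\rho(z,x)(v)+\nu(x)(v\wedge w)+\nu(y)(w\wedge u)+\nu(z)(u\wedge v).$$ *)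

theory Defs
  imports
    "HOL-Analysis.Product_Vector"
    "HOL-Combinatorics.Permutations"
    "HOL-Computational_Algebra.Polynomial"
begin

text \<open>
  A vector space over a field \<open>'k\<close> is a type of class \<^class>\<open>ab_group_add\<close> together with a scalar
  multiplication satisfying \<^locale>\<open>vector_space\<close>. The direct sum of two vector spaces is the
  product type with scalar multiplication \<open>module_prod.scale\<close>.
\<close>

section \<open>3-Lie algebras\<close>

locale three_lie_algebra = vector_space s
  for s :: "'k::field \<Rightarrow> 'a::ab_group_add \<Rightarrow> 'a" +
  fixes br :: "'a \<Rightarrow> 'a \<Rightarrow> 'a \<Rightarrow> 'a"
  assumes linear1: "Vector_Spaces.linear s s (\<lambda>x. br x y z)"
    and linear2: "Vector_Spaces.linear s s (\<lambda>y. br x y z)"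
    and linear3: "Vector_Spaces.linear s s (\<lambda>z. br x y z)"
    and skew12: "br y x z = - br x y z"
    and skew23: "br x z y = - br x y z"
    and fundamental_identity:
      "br x1 x2 (br x3 x4 x5) =
         br (br x1 x2 x3) x4 x5 + br x3 (br x1 x2 x4) x5 + br x3 x4 (br x1 x2 x5)"

locale three_lie_hom =
  A: three_lie_algebra sA brA + B: three_lie_algebra sB brB + Vector_Spaces.linear sA sB f
  for sA :: "'k::field \<Rightarrow> 'a::ab_group_add \<Rightarrow> 'a" and brA
    and sB :: "'k \<Rightarrow> 'b::ab_group_add \<Rightarrow> 'b" and brB
    and f :: "'a \<Rightarrow> 'b" +
  assumes hom_bracket: "f (brA x y z) = brB (f x) (f y) (f z)"

locale three_lie_iso = three_lie_hom +
  assumes bij: "bij f"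

section \<open>Abelian extensions\<close>

text \<open>Short exact sequences \<open>0 \<rightarrow> V \<rightarrow> H \<rightarrow> G \<rightarrow> 0\<close> of 3-Lie algebras with \<open>V\<close> abelian\<close>

locale abelian_extension =
  incl: three_lie_hom sV brV sH brH i + proj: three_lie_hom sH brH sG brG p
  for sV :: "'k::field \<Rightarrow> 'v::ab_group_add \<Rightarrow> 'v" and brV
    and sH :: "'k \<Rightarrow> 'h::ab_group_add \<Rightarrow> 'h" and brH
    and sG :: "'k \<Rightarrow> 'g::ab_group_add \<Rightarrow> 'g" and brG
    and i :: "'v \<Rightarrow> 'h" and p :: "'h \<Rightarrow> 'g" +
  assumes exact_left: "inj i"
    and exact_middle: "range i = {h. p h = 0}"
    and exact_right: "surj p"
    and abelian: "brV u v w = 0"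

locale split_abelian_extension = abelian_extension +
  assumes split: "\<exists>\<sigma>. p \<circ> \<sigma> = id \<and> three_lie_hom sG brG sH brH \<sigma>"

section \<open>The graded Lie algebra of a vector space\<close>

text \<open>Linear maps out of an exterior square, as alternating bilinear maps\<close>

definition alternating_bilinear ::
  "('k::field \<Rightarrow> 'a::ab_group_add \<Rightarrow> 'a) \<Rightarrow> ('k \<Rightarrow> 'b::ab_group_add \<Rightarrow> 'b) \<Rightarrow> ('a \<Rightarrow> 'a \<Rightarrow> 'b) \<Rightarrow> bool"
  where "alternating_bilinear s1 s2 f \<longleftrightarrow>
    (\<forall>y. Vector_Spaces.linear s1 s2 (\<lambda>x. f x y)) \<and>
    (\<forall>x. Vector_Spaces.linear s1 s2 (\<lambda>y. f x y)) \<and>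
    (\<forall>x. f x x = 0)"

lemma alternating_bilinear_swap:
  assumes "alternating_bilinear s1 s2 f"
  shows "f y x = - f x y"
proof -
  have L: "\<And>y. Vector_Spaces.linear s1 s2 (\<lambda>x. f x y)" "\<And>x. Vector_Spaces.linear s1 s2 (\<lambda>y. f x y)"
    using assms by (auto simp: alternating_bilinear_def)
  have "f (x+y) (x+y) = 0" "f x x = 0" "f y y = 0"
    using assms by (auto simp: alternating_bilinear_def)
  then have "f x y + f y x = 0"
    by (simp add: L[unfolded Vector_Spaces.linear_iff_module_hom module_hom_iff] add.commute)
  then show ?thesis by (metis minus_unique)
qed

text \<open>
  A cochain of degree \<open>p\<close> is given by its values \<open>\<alpha> [(x\<^sub>1, y\<^sub>1), \<dots>, (x\<^sub>p, y\<^sub>p)] x\<close> on decomposable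
  elements \<open>(x\<^sub>1 \<and> y\<^sub>1) \<otimes> \<dots> \<otimes> (x\<^sub>p \<and> y\<^sub>p) \<otimes> x\<close>; it is set to zero on lists whose length is not \<open>p\<close>,
  so that equality of cochains is equality of functions. Skew-symmetry in the last three arguments
  amounts to skew-symmetry in the last two, the \<open>p\<close>-th pair being alternating anyway.
\<close>

type_synonym 'w cochain = "('w \<times> 'w) list \<Rightarrow> 'w \<Rightarrow> 'w"

definition cochains :: "('k::field \<Rightarrow> 'w::ab_group_add \<Rightarrow> 'w) \<Rightarrow> nat \<Rightarrow> 'w cochain set" where
  "cochains s p = {\<alpha>.
     (\<forall>Xs x. length Xs \<noteq> p \<longrightarrow> \<alpha> Xs x = 0) \<and>
     (\<forall>Xs. length Xs = p \<longrightarrow> Vector_Spaces.linear s s (\<alpha> Xs)) \<and>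
     (\<forall>Xs Ys x. length Xs + 1 + length Ys = p \<longrightarrow>
        alternating_bilinear s s (\<lambda>a b. \<alpha> (Xs @ (a, b) # Ys) x)) \<and>
     (\<forall>Xs a b x. length Xs + 1 = p \<longrightarrow> \<alpha> (Xs @ [(a, x)]) b = - \<alpha> (Xs @ [(a, b)]) x)}"

text \<open>The sign \<open>(-1)\<close> to the \<open>(J,I)\<close> of the permutation obtained by listing \<open>J\<close> and then
  \<open>I = {0..<n} - J\<close>, each in increasing order\<close>

definition shuffle_sign :: "nat \<Rightarrow> nat set \<Rightarrow> int" where
  "shuffle_sign n J = sign (\<lambda>m. if m < n
     then (sorted_list_of_set J @ sorted_list_of_set ({..<n} - J)) ! m else m)"

text \<open>
  Indices start at \<open>0\<close>: the pairs \<open>Xs ! 0, \<dots>, Xs ! (p + q - 1)\<close> have the indices \<open>0, \<dots>, p + q - 1\<close>,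
  and the last argument \<open>x\<close> has the index \<open>p + q\<close>. In the first sum \<open>p + q \<in> I\<close>, so that the
  pairs of index in \<open>I\<close> are listed by \<open>butlast is\<close>.
\<close>

definition circ ::
  "('k::field \<Rightarrow> 'w::ab_group_add \<Rightarrow> 'w) \<Rightarrow> nat \<Rightarrow> nat \<Rightarrow> 'w cochain \<Rightarrow> 'w cochain \<Rightarrow> 'w cochain"
  where "circ s p q \<alpha> \<beta> Xs x = (if length Xs \<noteq> p + q then 0 else
    (\<Sum>J | J \<subseteq> {..p+q} \<and> card J = q + 1 \<and> Max J < p + q.
       let I = {..p+q} - J; js = sorted_list_of_set J; is = sorted_list_of_set I;
           j = Max J; k = card {i \<in> I. i < j}; X = (\<lambda>i. Xs ! i);
           \<beta>J = \<beta> (map X (butlast js))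
       in s (of_int (shuffle_sign (p + q + 1) J) * (-1) ^ k)
            (\<alpha> (map X (take k is) @ (\<beta>J (fst (X j)), snd (X j)) # map X (drop k (butlast is))) x
             + \<alpha> (map X (take k is) @ (fst (X j), \<beta>J (snd (X j))) # map X (drop k (butlast is))) x))
    + (\<Sum>J | J \<subseteq> {..p+q} \<and> card J = q + 1 \<and> Max J = p + q.
       let I = {..p+q} - J; js = sorted_list_of_set J; is = sorted_list_of_set I; X = (\<lambda>i. Xs ! i)
       in s (of_int (shuffle_sign (p + q + 1) J) * (-1) ^ p)
            (\<alpha> (map X is) (\<beta> (map X (butlast js)) x))))"

definition three_lie_bracket ::
  "('k::field \<Rightarrow> 'w::ab_group_add \<Rightarrow> 'w) \<Rightarrow> nat \<Rightarrow> nat \<Rightarrow> 'w cochain \<Rightarrow> 'w cochain \<Rightarrow> 'w cochain"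
  where "three_lie_bracket s p q \<alpha> \<beta> Xs x =
    s ((-1) ^ (p * q)) (circ s p q \<alpha> \<beta> Xs x) - circ s q p \<beta> \<alpha> Xs x"

text \<open>A trilinear map as a cochain of degree 1\<close>

definition cochain1 :: "('w \<Rightarrow> 'w \<Rightarrow> 'w \<Rightarrow> 'w::zero) \<Rightarrow> 'w cochain" where
  "cochain1 f Xs x = (case Xs of [(a, b)] \<Rightarrow> f a b x | _ \<Rightarrow> 0)"

section \<open>Generalized representations\<close>

definition pi_ext ::
  "('g \<Rightarrow> 'g \<Rightarrow> 'g \<Rightarrow> 'g) \<Rightarrow> 'g \<times> 'v \<Rightarrow> 'g \<times> 'v \<Rightarrow> 'g \<times> 'v \<Rightarrow> 'g \<times> 'v::zero" where
  "pi_ext br = (\<lambda>(x, u) (y, v) (z, w). (br x y z, 0))"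

definition rho_bar ::
  "('g \<Rightarrow> 'g \<Rightarrow> 'v \<Rightarrow> 'v) \<Rightarrow> 'g \<times> 'v \<Rightarrow> 'g \<times> 'v \<Rightarrow> 'g \<times> 'v \<Rightarrow> 'g::zero \<times> 'v::plus" where
  "rho_bar \<rho> = (\<lambda>(x, u) (y, v) (z, w). (0, \<rho> x y w + \<rho> y z u + \<rho> z x v))"

definition nu_bar ::
  "('g \<Rightarrow> 'v \<Rightarrow> 'v \<Rightarrow> 'v) \<Rightarrow> 'g \<times> 'v \<Rightarrow> 'g \<times> 'v \<Rightarrow> 'g \<times> 'v \<Rightarrow> 'g::zero \<times> 'v::plus" where
  "nu_bar \<nu> = (\<lambda>(x, u) (y, v) (z, w). (0, \<nu> x v w + \<nu> y w u + \<nu> z u v))"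

definition structure_cochain ::
  "('g \<Rightarrow> 'g \<Rightarrow> 'g \<Rightarrow> 'g) \<Rightarrow> ('g \<Rightarrow> 'g \<Rightarrow> 'v \<Rightarrow> 'v) \<Rightarrow> ('g \<Rightarrow> 'v \<Rightarrow> 'v \<Rightarrow> 'v) \<Rightarrow>
    ('g::ab_group_add \<times> 'v::ab_group_add) cochain" where
  "structure_cochain br \<rho> \<nu> =
     cochain1 (\<lambda>a b c. pi_ext br a b c + rho_bar \<rho> a b c + nu_bar \<nu> a b c)"

lemma structure_cochain_in_cochains:
  fixes sG :: "'k::field_char_0 \<Rightarrow> 'g::ab_group_add \<Rightarrow> 'g" and sV :: "'k \<Rightarrow> 'v::ab_group_add \<Rightarrow> 'v"
  assumes "three_lie_algebra sG brG" "vector_space sV"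
    "\<And>x y. Vector_Spaces.linear sV sV (\<rho> x y)"
    "\<And>v. alternating_bilinear sG sV (\<lambda>x y. \<rho> x y v)"
    "\<And>x. alternating_bilinear sV sV (\<nu> x)"
    "\<And>v w. Vector_Spaces.linear sG sV (\<lambda>x. \<nu> x v w)"
  shows "structure_cochain brG \<rho> \<nu> \<in> cochains (module_prod.scale sG sV) 1"
proof -
  interpret G: three_lie_algebra sG brG by fact
  interpret V: vector_space sV by fact
  interpret P: vector_space_prod sG sV by unfold_locales
  note L = assms(3,6) assms(4,5)[unfolded alternating_bilinear_def] G.linear1 G.linear2 G.linear3
  note L' = L[unfolded Vector_Spaces.linear_iff_module_hom module_hom_iff]
  have t: "a = 0" if "a = - a" for a :: 'g
  proof -
    have "sG 2 a = sG (1 + 1) a" by simp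
    also have "\<dots> = a + a" by (simp only: G.scale_left_distrib G.scale_one)
    also have "\<dots> = 0" using that by (metis add.right_inverse)
    finally show ?thesis by simp
  qed
  have z: "brG x x y = 0" "brG x y y = 0" for x y
    by (rule t, rule G.skew12) (rule t, rule G.skew23)
  have r: "\<rho> y x v = - \<rho> x y v" for x y v using alternating_bilinear_swap[OF assms(4)] .
  have n: "\<nu> x w v = - \<nu> x v w" for x v w using alternating_bilinear_swap[OF assms(5)] .
  show ?thesis
    unfolding cochains_def structure_cochain_def cochain1_def alternating_bilinear_def
      Vector_Spaces.linear_iff_module_hom module_hom_iff
    apply (auto simp: P.scale_def pi_ext_def rho_bar_def nu_bar_def L' z algebra_simps
        P.p.module_axioms split: list.splits)
    subgoal for x u y v by (simp add: n[of y u v] r[of y x v] zero_prod_def)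
    subgoal by (rule G.skew23)
    subgoal for x u y v z w
      by (simp add: n[of x v w] n[of y u w] n[of z u v] r[of y x w] r[of z x v] r[of z y u])
    done
qed

locale generalized_representation =
  G: three_lie_algebra sG brG + V: vector_space sV
  for sG :: "'k::field \<Rightarrow> 'g::ab_group_add \<Rightarrow> 'g" and brG
    and sV :: "'k \<Rightarrow> 'v::ab_group_add \<Rightarrow> 'v" +
  fixes \<rho> :: "'g \<Rightarrow> 'g \<Rightarrow> 'v \<Rightarrow> 'v" and \<nu> :: "'g \<Rightarrow> 'v \<Rightarrow> 'v \<Rightarrow> 'v"
  assumes rho_endo: "Vector_Spaces.linear sV sV (\<rho> x y)"
    and rho_wedge: "alternating_bilinear sG sV (\<lambda>x y. \<rho> x y v)"
    and nu_wedge: "alternating_bilinear sV sV (\<nu> x)"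
    and nu_linear: "Vector_Spaces.linear sG sV (\<lambda>x. \<nu> x v w)"
    and maurer_cartan:
      "three_lie_bracket (module_prod.scale sG sV) 1 1
         (structure_cochain brG \<rho> \<nu>) (structure_cochain brG \<rho> \<nu>) = (\<lambda>Xs x. 0)"

definition semidirect_bracket ::
  "('g \<Rightarrow> 'g \<Rightarrow> 'g \<Rightarrow> 'g) \<Rightarrow> ('g \<Rightarrow> 'g \<Rightarrow> 'v \<Rightarrow> 'v) \<Rightarrow> ('g \<Rightarrow> 'v \<Rightarrow> 'v \<Rightarrow> 'v) \<Rightarrow>
    'g \<times> 'v \<Rightarrow> 'g \<times> 'v \<Rightarrow> 'g \<times> 'v \<Rightarrow> 'g \<times> 'v::plus" where
  "semidirect_bracket br \<rho> \<nu> = (\<lambda>(x, u) (y, v) (z, w).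
     (br x y z, \<rho> x y w + \<rho> y z u + \<rho> z x v + \<nu> x v w + \<nu> y w u + \<nu> z u v))"

end

theory Submission
  imports Defs
begin

text \<open>
  Let \<open>\<sigma>\<close> be a splitting that respects the brackets. Then \<open>\<psi> (x, u) = \<sigma> x + i u\<close> is a linear
  isomorphism from \<open>G \<oplus> V\<close> onto \<open>H\<close>. Expanding a bracket of three values of \<open>\<psi>\<close> by trilinearity
  gives eight terms. The term with three factors from \<open>G\<close> is \<open>\<sigma>\<close> of a bracket of \<open>G\<close>, the term with
  three factors from \<open>V\<close> vanishes because \<open>V\<close> is abelian, and the six mixed terms lie in the
  kernel of \<open>p\<close>, which is the image of \<open>i\<close>. Those with one factor from \<open>V\<close> define \<open>\<rho>\<close>, those with
  two define \<open>\<nu>\<close> (an abelian subalgebra that is an ideal may still act through two of its elements,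
  which is why \<open>\<nu>\<close> is needed). So \<open>\<psi>\<close> carries the semidirect bracket of \<open>\<rho>\<close> and \<open>\<nu>\<close> to the
  bracket of \<open>H\<close>, and the semidirect bracket is a 3-Lie bracket.

  It remains to see that \<open>\<rho>\<close> and \<open>\<nu>\<close> satisfy the Maurer--Cartan equation. The structure cochain is
  the semidirect bracket, regarded as a cochain of degree 1. In degree 1 the circle product of a
  trilinear map with itself is the defect of the fundamental identity (lemma \<open>circ_cochain1\<close>),
  so every 3-Lie bracket solves the equation: \<open>[\<alpha>, \<alpha>] = -2 (\<alpha> \<circ> \<alpha>)\<close> in degree 1.
\<close>

section \<open>The Maurer--Cartan equation and the fundamental identity\<close>

lemma shuffle_sign_3:
  "shuffle_sign 3 {0, 1} = 1" "shuffle_sign 3 {0, 2} = -1" "shuffle_sign 3 {1, 2} = 1"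
proof -
  have I: "{..<3} - {0, 1} = {2::nat}" "{..<3} - {0, 2} = {1::nat}" "{..<3} - {1, 2} = {0::nat}"
    by auto
  have "(\<lambda>m. if m < 3 then (sorted_list_of_set {0, 1} @ sorted_list_of_set ({..<3} - {0, 1})) ! m
      else m) = (id :: nat \<Rightarrow> nat)"
    unfolding I by (auto simp: fun_eq_iff less_Suc_eq numeral_3_eq_3)
  then show "shuffle_sign 3 {0, 1} = 1"
    unfolding shuffle_sign_def by simp
  have "(\<lambda>m. if m < 3 then (sorted_list_of_set {0, 2} @ sorted_list_of_set ({..<3} - {0, 2})) ! m
      else m) = transpose 1 (2 :: nat)"
    unfolding I by (auto simp: fun_eq_iff less_Suc_eq numeral_3_eq_3 numeral_2_eq_2 transpose_def)
  then show "shuffle_sign 3 {0, 2} = -1"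
    unfolding shuffle_sign_def by (simp add: sign_swap_id)
  have "(\<lambda>m. if m < 3 then (sorted_list_of_set {1, 2} @ sorted_list_of_set ({..<3} - {1, 2})) ! m
      else m) = transpose 0 1 \<circ> transpose 1 (2 :: nat)"
    unfolding I by (auto simp: fun_eq_iff less_Suc_eq numeral_3_eq_3 numeral_2_eq_2 transpose_def)
  then show "shuffle_sign 3 {1, 2} = 1"
    unfolding shuffle_sign_def by (simp add: sign_compose permutation_swap_id sign_swap_id)
qed

text \<open>
  The two-element subsets of \<open>{0, 1, 2}\<close> give the four terms of the fundamental identity: \<open>{0, 1}\<close>
  gives two of them, and the signs of the shuffles \<open>(0, 2, 1)\<close> and \<open>(1, 2, 0)\<close>, times \<open>(-1)\<^sup>p = -1\<close>,
  give the other two.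
\<close>

lemma circ_cochain1:
  assumes "vector_space s"
  shows "circ s 1 1 (cochain1 f) (cochain1 f) [(a, b), (c, d)] x =
    f (f a b c) d x + f c (f a b d) x + f c d (f a b x) - f a b (f c d x)"
proof -
  interpret vector_space s by fact
  have P: "{J::nat set. J \<subseteq> {..2} \<and> Q J} =
      {J \<in> {{}, {0}, {1}, {2}, {0,1}, {0,2}, {1,2}, {0,1,2}}. Q J}" for Q
  proof -
    have "{..2::nat} = {0,1,2}" by auto
    then have "Pow {..2::nat} = {{}, {0}, {1}, {2}, {0,1}, {0,2}, {1,2}, {0,1,2}}"
      by (simp add: Pow_insert insert_commute)
    from this[symmetric] show ?thesis by (simp only: Pow_iff)
  qed
  have A: "{J::nat set. J \<subseteq> {..2} \<and> card J = 2 \<and> Max J < 2} = {{0, 1}}"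
    unfolding P by auto
  have B: "{J::nat set. J \<subseteq> {..2} \<and> card J = 2 \<and> Max J = 2} = {{0, 2}, {1, 2}}"
    unfolding P by auto
  have C: "{0, 2} \<noteq> {1, 2::nat}" by auto
  have I: "{..2} - {0, 1} = {2::nat}" "{..2} - {0, 2} = {1::nat}" "{..2} - {1, 2} = {0::nat}"
    by auto
  have J: "Max {0, 1::nat} = 1" "sorted_list_of_set {0, 1::nat} = [0, 1]"
    "sorted_list_of_set {0, 2::nat} = [0, 2]" "sorted_list_of_set {1, 2::nat} = [1, 2]"
    by auto
  have n: "(1::nat) + 1 = 2" "(2::nat) + 1 = 3" by auto
  show ?thesis
    unfolding circ_def n A B
    using C by (simp add: Let_def I J cochain1_def shuffle_sign_3 del: One_nat_def cong: conj_cong)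
qed

lemma three_lie_bracket_cochain1:
  assumes "three_lie_algebra s br"
  shows "three_lie_bracket s 1 1 (cochain1 br) (cochain1 br) = (\<lambda>Xs x. 0)"
proof -
  interpret three_lie_algebra s br by fact
  have "circ s 1 1 (cochain1 br) (cochain1 br) Xs x = 0" for Xs x
  proof (cases "length Xs = 2")
    case True
    then obtain a b c d where "Xs = [(a, b), (c, d)]"
      by (auto simp: length_Suc_conv numeral_2_eq_2)
    then show ?thesis
      by (simp only: circ_cochain1[OF vector_space_axioms] fundamental_identity[of a b c d x]) simp
  next
    case False
    then show ?thesis by (simp add: circ_def)
  qed
  then show ?thesis by (simp add: three_lie_bracket_def fun_eq_iff)
qed

lemma structure_cochain_eq: "structure_cochain br \<rho> \<nu> = cochain1 (semidirect_bracket br \<rho> \<nu>)"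
  unfolding structure_cochain_def
  by (rule arg_cong[of _ _ cochain1])
    (simp add: fun_eq_iff semidirect_bracket_def pi_ext_def rho_bar_def nu_bar_def add.assoc)

section \<open>Transport of 3-Lie brackets\<close>

lemma three_lie_algebra_pullback:
  assumes B: "three_lie_algebra sB brB" and f: "Vector_Spaces.linear sA sB f" and "inj f"
    and hom: "\<And>x y z. f (brA x y z) = brB (f x) (f y) (f z)"
  shows "three_lie_algebra sA brA"
proof -
  interpret B: three_lie_algebra sB brB by fact
  interpret f: Vector_Spaces.linear sA sB f by fact
  note L = B.linear1 B.linear2 B.linear3
  note L' = L[unfolded Vector_Spaces.linear_iff_module_hom module_hom_iff]
  note eqI = injD[OF \<open>inj f\<close>]
  show ?thesis
  proof
    show "brA y x z = - brA x y z" for x y z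
      by (rule eqI) (simp add: hom f.neg B.skew12[of "f y"])
    show "brA x z y = - brA x y z" for x y z
      by (rule eqI) (simp add: hom f.neg B.skew23[of _ "f z"])
    show "brA x1 x2 (brA x3 x4 x5) =
        brA (brA x1 x2 x3) x4 x5 + brA x3 (brA x1 x2 x4) x5 + brA x3 x4 (brA x1 x2 x5)"
      for x1 x2 x3 x4 x5
      by (rule eqI) (simp add: hom f.add B.fundamental_identity[of "f x1" "f x2"])
  qed (auto intro!: eqI simp: hom f.add f.scale L')
qed

lemma three_lie_iso_of_linear_bij:
  assumes B: "three_lie_algebra sB brB" and f: "Vector_Spaces.linear sA sB f" and "bij f"
    and hom: "\<And>x y z. f (brA x y z) = brB (f x) (f y) (f z)"
  shows "three_lie_iso sA brA sB brB f" "three_lie_iso sB brB sA brA (inv f)"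
proof -
  have A: "three_lie_algebra sA brA"
    by (rule three_lie_algebra_pullback[OF B f bij_is_inj[OF \<open>bij f\<close>]]) (rule hom)
  interpret f: Vector_Spaces.linear sA sB f by fact
  note f_inv = bij_inv_eq_iff[OF \<open>bij f\<close>] surj_f_inv_f[OF bij_is_surj[OF \<open>bij f\<close>]]
    inv_f_f[OF bij_is_inj[OF \<open>bij f\<close>]]
  show "three_lie_iso sA brA sB brB f"
    using A B f hom \<open>bij f\<close>
    by (simp add: three_lie_iso_def three_lie_iso_axioms_def three_lie_hom_def
        three_lie_hom_axioms_def)
  have "inv f (x + y) = inv f x + inv f y" for x y
    using f_inv by (metis f.add)
  moreover have "inv f (sB c x) = sA c (inv f x)" for c x
    using f_inv by (metis f.scale)
  ultimately have "Vector_Spaces.linear sB sA (inv f)"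
    using f.vs1.vector_space_axioms f.vs2.vector_space_axioms
    by (simp add: Vector_Spaces.linear_iff)
  moreover have "inv f (brB x y z) = brA (inv f x) (inv f y) (inv f z)" for x y z
    using f_inv by (metis hom)
  ultimately show "three_lie_iso sB brB sA brA (inv f)"
    using A B bij_imp_bij_inv[OF \<open>bij f\<close>]
    by (simp add: three_lie_iso_def three_lie_iso_axioms_def three_lie_hom_def
        three_lie_hom_axioms_def)
qed

section \<open>Split abelian extensions\<close>

text \<open>Since \<open>2\<close> is invertible, skew-symmetry makes the bracket alternating.\<close>

lemma bracket_repeat_eq_0:
  fixes s :: "'k::field_char_0 \<Rightarrow> 'a::ab_group_add \<Rightarrow> 'a"
  assumes "three_lie_algebra s br"
  shows "br x x y = 0" "br x y y = 0"
proof -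
  interpret three_lie_algebra s br by fact
  have t: "a = 0" if "a = - a" for a :: 'a
  proof -
    have "s 2 a = s (1 + 1) a" by simp
    also have "\<dots> = a + a" by (simp only: scale_left_distrib scale_one)
    also have "\<dots> = 0" using that by (metis add.right_inverse)
    finally show ?thesis by simp
  qed
  show "br x x y = 0" "br x y y = 0"
    by (rule t, rule skew12) (rule t, rule skew23)
qed

text \<open>
  A linear section \<open>\<sigma>\<close> splits \<open>h\<close> into \<open>\<sigma> (p h)\<close> and \<open>h - \<sigma> (p h)\<close>, which \<open>p\<close> sends to \<open>0\<close>
  and which therefore comes from \<open>V\<close>; applying \<open>p\<close> to \<open>\<sigma> x + i u\<close> recovers \<open>x\<close>.
\<close>

lemma (in abelian_extension) bij_section_plus_incl:
  assumes "Vector_Spaces.linear sG sH \<sigma>" and "p \<circ> \<sigma> = id"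
  shows "bij (\<lambda>(x, u). \<sigma> x + i u)"
proof -
  interpret \<sigma>: Vector_Spaces.linear sG sH \<sigma> by fact
  have p_sigma: "p (\<sigma> x) = x" for x using \<open>p \<circ> \<sigma> = id\<close> by (simp add: fun_eq_iff)
  have p_i: "p (i u) = 0" for u using exact_middle by blast
  show ?thesis
  proof (rule bijI)
    show "inj (\<lambda>(x, u). \<sigma> x + i u)"
    proof (rule injI, clarify)
      fix x u y v
      assume eq: "\<sigma> x + i u = \<sigma> y + i v"
      from arg_cong[OF this, of p] have "x = y"
        by (simp add: proj.add p_sigma p_i)
      with eq show "x = y \<and> u = v"
        using exact_left by (simp add: inj_eq)
    qed
    show "surj (\<lambda>(x, u). \<sigma> x + i u)"
    proof (rule surjI)
      fix h
      have "p (h - \<sigma> (p h)) = 0" by (simp add: proj.diff p_sigma)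
      then have "h - \<sigma> (p h) \<in> range i" using exact_middle by blast
      then show "(\<lambda>(x, u). \<sigma> x + i u) (p h, inv i (h - \<sigma> (p h))) = h"
        by (simp add: f_inv_into_f)
    qed
  qed
qed

text \<open>
  The mixed brackets have a factor in the kernel of \<open>p\<close>, hence lie in the kernel of \<open>p\<close>, and can be
  pulled back along \<open>i\<close> to define \<open>\<rho>\<close> and \<open>\<nu>\<close>. As \<open>i\<close> is injective, linearity and alternation of \<open>\<rho>\<close>
  and \<open>\<nu>\<close> can be checked after applying \<open>i\<close>, where they are those of the bracket of \<open>H\<close>.
\<close>

theorem proposition5p1:
  fixes sV :: "'k::{alg_closed_field, field_char_0} \<Rightarrow> 'v::ab_group_add \<Rightarrow> 'v"
    and sH :: "'k \<Rightarrow> 'h::ab_group_add \<Rightarrow> 'h"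
    and sG :: "'k \<Rightarrow> 'g::ab_group_add \<Rightarrow> 'g"
    and brV :: "'v \<Rightarrow> 'v \<Rightarrow> 'v \<Rightarrow> 'v"
    and brH :: "'h \<Rightarrow> 'h \<Rightarrow> 'h \<Rightarrow> 'h"
    and brG :: "'g \<Rightarrow> 'g \<Rightarrow> 'g \<Rightarrow> 'g"
    and i :: "'v \<Rightarrow> 'h" and p :: "'h \<Rightarrow> 'g"
  assumes "split_abelian_extension sV brV sH brH sG brG i p"
  shows "\<exists>\<rho> \<nu>. generalized_representation sG brG sV \<rho> \<nu> \<and>
           (\<exists>\<phi>. three_lie_iso sH brH
                  (module_prod.scale sG sV) (semidirect_bracket brG \<rho> \<nu>) \<phi>)"
proof -
  interpret split_abelian_extension sV brV sH brH sG brG i p by fact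
  obtain \<sigma> where "p \<circ> \<sigma> = id" and "three_lie_hom sG brG sH brH \<sigma>"
    using split by blast
  then interpret \<sigma>: three_lie_hom sG brG sH brH \<sigma> by simp
  interpret P: vector_space_prod sG sV by unfold_locales
  note H = incl.B.three_lie_algebra_axioms
  note lin = incl.B.linear1 incl.B.linear2 incl.B.linear3
    proj.B.linear1 proj.B.linear2 proj.B.linear3
  note L = lin[unfolded Vector_Spaces.linear_iff_module_hom module_hom_iff]
  note zero = lin[unfolded Vector_Spaces.linear_iff_module_hom, THEN module_hom.zero]
  note alt = bracket_repeat_eq_0[OF H]
  note iI = injD[OF exact_left]
  note [simp] = incl.add incl.scale incl.neg \<sigma>.add \<sigma>.scale
  have p_i: "p (i u) = 0" for u using exact_middle by blast
  define \<rho> where "\<rho> x y w = inv i (brH (\<sigma> x) (\<sigma> y) (i w))" for x y w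
  define \<nu> where "\<nu> x v w = inv i (brH (\<sigma> x) (i v) (i w))" for x v w
  have ideal: "brH a b (i w) \<in> range i" for a b w
    using exact_middle by (simp add: proj.hom_bracket p_i zero)
  have i_rho: "i (\<rho> x y w) = brH (\<sigma> x) (\<sigma> y) (i w)"
    and i_nu: "i (\<nu> x v w) = brH (\<sigma> x) (i v) (i w)" for x y v w
    unfolding \<rho>_def \<nu>_def by (rule f_inv_into_f[OF ideal])+
  have i_br: "brH (i u) (i v) (i w) = 0" for u v w
    using incl.hom_bracket[of u v w] by (simp add: abelian)
  define \<psi> where "\<psi> = (\<lambda>(x, u). \<sigma> x + i u)"
  have psi_linear: "Vector_Spaces.linear P.scale sH \<psi>"
    using P.p.vector_space_axioms incl.B.vector_space_axioms
    by (auto simp: Vector_Spaces.linear_iff \<psi>_def P.scale_def L incl.B.scale_right_distrib)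
  have psi_bij: "bij \<psi>"
    unfolding \<psi>_def using \<sigma>.linear_axioms \<open>p \<circ> \<sigma> = id\<close> by (rule bij_section_plus_incl)
  have psi_hom: "\<psi> (semidirect_bracket brG \<rho> \<nu> a b c) = brH (\<psi> a) (\<psi> b) (\<psi> c)" for a b c
  proof -
    obtain x u y v z w where abc: "a = (x, u)" "b = (y, v)" "c = (z, w)"
      by (metis surj_pair)
    \<comment> \<open>Cyclic permutations are even, so they bring the mixed brackets into the order of
      \<open>\<rho>\<close> and \<open>\<nu>\<close>.\<close>
    have cyc: "brH d e f = brH e f d" for d e f
      by (metis incl.B.skew12 incl.B.skew23 minus_minus)
    have mixed: "brH (i u) (\<sigma> y) (\<sigma> z) = i (\<rho> y z u)" "brH (\<sigma> x) (i v) (\<sigma> z) = i (\<rho> z x v)"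
      "brH (i u) (\<sigma> y) (i w) = i (\<nu> y w u)" "brH (i u) (i v) (\<sigma> z) = i (\<nu> z u v)"
      unfolding i_rho i_nu by (metis cyc)+
    show ?thesis
      by (simp add: abc semidirect_bracket_def \<psi>_def \<sigma>.hom_bracket L i_br mixed
          i_rho[symmetric] i_nu[symmetric] add_ac)
  qed
  have iso: "three_lie_iso P.scale (semidirect_bracket brG \<rho> \<nu>) sH brH \<psi>"
    "three_lie_iso sH brH P.scale (semidirect_bracket brG \<rho> \<nu>) (inv \<psi>)"
    by (rule three_lie_iso_of_linear_bij[OF H psi_linear psi_bij], rule psi_hom)+
  interpret S: three_lie_iso P.scale "semidirect_bracket brG \<rho> \<nu>" sH brH \<psi>
    by (rule iso(1))
  have "generalized_representation sG brG sV \<rho> \<nu>"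
  proof (intro generalized_representation.intro generalized_representation_axioms.intro)
    show "three_lie_algebra sG brG" and "vector_space sV" by unfold_locales
    show "Vector_Spaces.linear sV sV (\<rho> x y)" for x y
      using incl.A.vector_space_axioms
      by (auto simp: Vector_Spaces.linear_iff i_rho L intro!: iI)
    show "alternating_bilinear sG sV (\<lambda>x y. \<rho> x y v)" for v
      using incl.A.vector_space_axioms proj.B.vector_space_axioms
      by (auto simp: alternating_bilinear_def Vector_Spaces.linear_iff i_rho L alt intro!: iI)
    show "alternating_bilinear sV sV (\<nu> x)" for x
      using incl.A.vector_space_axioms
      by (auto simp: alternating_bilinear_def Vector_Spaces.linear_iff i_nu L alt intro!: iI)
    show "Vector_Spaces.linear sG sV (\<lambda>x. \<nu> x v w)" for v w
      using incl.A.vector_space_axioms proj.B.vector_space_axioms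
      by (auto simp: Vector_Spaces.linear_iff i_nu L intro!: iI)
    show "three_lie_bracket P.scale 1 1 (structure_cochain brG \<rho> \<nu>) (structure_cochain brG \<rho> \<nu>)
        = (\<lambda>Xs x. 0)"
      unfolding structure_cochain_eq
      by (rule three_lie_bracket_cochain1) (rule S.A.three_lie_algebra_axioms)
  qed
  with iso(2) show ?thesis by blast
qed

end
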